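(* Suppose $|\mathbb F|=q<\infty$, $r\geq1$, and that $r=m=n$ does not hold. If $0\leq s\leq r$, then $|E_J(D_s^J)|=q^{s(m+n-r-s)}\begin{bmatrix}r\\ s\end{bmatrix}_q$. Consequently, $$|E_J(\mathcal M_{mn}^J)|=\sum_{s=0}^rq^{s(m+n-r-s)}\begin{bmatrix}r\\ s\end{bmatrix}_q.$$
   Context: Let $\mathbb F$ be a field, $m,n\geq1$ integers, and $r\leq\min(m,n)$. $\mathcal M_{kl}$ denotes the set of all $k\times l$ matrices over $\mathbb F$. Let $J=\begin{bmatrix}I_r&O\\O&O\end{bmatrix}\in\mathcal M_{nm}$ (an $n\times m$ matrix), and let $\mathcal M_{mn}^J$ be the semigroup with underlying set $\mathcal M_{mn}$ and operation $X\star Y=XJY$. $P=\operatorname{Reg}(\mathcal M_{mn}^J)$ is the set of all regular elements (those $X$ with $X=X\star Y\star X$ for some $Y$), and $D_s^J=\{X\in P:\operatorname{rank}(X)=s\}$. For $\Omega\subseteq\mathcal M_{mn}$, $E_J(\Omega)=\{X\in\Omega:X=X\star X\}$. $[s]_q!=\prod_{i=1}^s(1+q+\cdots+q^{i-1})$, and $\begin{bmatrix}k\\ s\end{bmatrix}_q=\frac{[k]_q!}{[s]_q!\,[k-s]_q!}$ is the $q$-binomial coefficient. *)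

theory Defs
  imports "Jordan_Normal_Form.DL_Rank"
begin

text \<open>The \<open>n \<times> m\<close> matrix with \<open>I\<^sub>r\<close> in its upper left corner; meant for \<open>r \<le> min m n\<close>.
  The argument order follows that of \<open>\<M>\<^sub>m\<^sub>n\<close>, not the shape of \<open>J\<close>.\<close>

definition J_mat :: "nat \<Rightarrow> nat \<Rightarrow> nat \<Rightarrow> 'a::field mat" where
  "J_mat m n r = four_block_mat (1\<^sub>m r) (0\<^sub>m r (m - r)) (0\<^sub>m (n - r) r) (0\<^sub>m (n - r) (m - r))"

definition sandwich :: "'a::field mat \<Rightarrow> 'a mat \<Rightarrow> 'a mat \<Rightarrow> 'a mat" where
  "sandwich J X Y = X * J * Y"

definition Reg :: "nat \<Rightarrow> nat \<Rightarrow> 'a::field mat \<Rightarrow> 'a mat set" where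
  "Reg m n J = {X \<in> carrier_mat m n. \<exists>Y \<in> carrier_mat m n. X = sandwich J (sandwich J X Y) X}"

text \<open>The first argument of \<^const>\<open>vec_space.rank\<close> is the number of rows of the matrix.\<close>

definition D_class :: "nat \<Rightarrow> nat \<Rightarrow> 'a::field mat \<Rightarrow> nat \<Rightarrow> 'a mat set" where
  "D_class m n J s = {X \<in> Reg m n J. vec_space.rank m X = s}"

definition idems :: "'a::field mat \<Rightarrow> 'a mat set \<Rightarrow> 'a mat set" where
  "idems J \<Omega> = {X \<in> \<Omega>. X = sandwich J X X}"

definition q_fact :: "'b::comm_semiring_1 \<Rightarrow> nat \<Rightarrow> 'b" where
  "q_fact q s = (\<Prod>i=1..s. \<Sum>j<i. q ^ j)"

text \<open>Defined by exact division in a field; meant for \<open>s \<le> k\<close>, since \<open>k - s\<close> is truncated.\<close>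

definition q_binomial :: "'b::field \<Rightarrow> nat \<Rightarrow> nat \<Rightarrow> 'b" where
  "q_binomial q k s = q_fact q k / (q_fact q s * q_fact q (k - s))"

end

theory Submission
  imports Defs
begin

text \<open>
  A matrix \<open>X\<close> of rank \<open>s\<close> satisfies \<open>X J X = X\<close> iff it factors as \<open>X = A B\<close> with
  \<open>A\<close> of shape \<open>m \<times> s\<close>, \<open>B\<close> of shape \<open>s \<times> n\<close> and \<open>B J A = I\<^sub>s\<close>; for a rank factorization,
  \<open>M = B J A\<close> is invertible and \<open>M\<^sup>3 = M\<^sup>2\<close>. The factorizations of a given \<open>X\<close> form a torsor
  under \<open>GL\<^sub>s\<close>, so the idempotents are counted by the quotient of the number of pairs
  \<open>(A, B)\<close> by \<open>\<bar>GL\<^sub>s\<bar>\<close>, which is itself the number of such pairs for \<open>J = I\<^sub>s\<close>. The pairs are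
  counted one column of \<open>A\<close> and one row of \<open>B\<close> at a time: the new column \<open>x\<close> lies in
  \<open>ker (B J)\<close> but not in \<open>ker J\<close>, which gives \<open>q\<^bsup>m - s\<^esup> - q\<^bsup>m - r\<^esup>\<close> choices, and the new row \<open>y\<close>
  solves the \<open>s + 1\<close> independent equations \<open>y J A = 0\<close>, \<open>y J x = 1\<close>, which gives
  \<open>q\<^bsup>n - s - 1\<^esup>\<close> choices.
\<close>

section \<open>Rank factorizations\<close>

text \<open>The dimensions of \<open>assoc_mult_mat\<close> do not all occur in its left-hand side;
  conditions on \<open>dim_row\<close> and \<open>dim_col\<close> let the simplifier normalise long
  products.\<close>

lemma mult_assoc_dim:
  fixes A :: "'a::semiring_0 mat"
  assumes "dim_col A = dim_row B" and "dim_col B = dim_row C"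
  shows "A * B * C = A * (B * C)"
  by (rule assoc_mult_mat[of _ "dim_row A" "dim_row B" _ "dim_row C" _ "dim_col C"])
    (use assms in auto)

text \<open>Each column of \<open>A * B\<close> is \<open>A\<close> applied to a column of
  \<open>B\<close>, so the column space of the product lies in that of \<open>A\<close>, which is
  spanned by \<open>t\<close> columns.\<close>

lemma (in vec_space) rank_mult_le:
  assumes A: "A \<in> carrier_mat n t" and B: "B \<in> carrier_mat t k"
  shows "rank (A * B) \<le> t"
proof -
  have cA: "set (cols A) \<subseteq> carrier V" and cAB: "set (cols (A * B)) \<subseteq> carrier V"
    using A B by (auto simp: cols_def)
  have "set (cols (A * B)) \<subseteq> col_space A"
  proof
    fix c assume "c \<in> set (cols (A * B))"
    then obtain j where j: "j < k" "c = col (A * B) j"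
      using B by (auto simp: cols_def)
    then have "c = A *\<^sub>v col B j" by (simp only: col_mult2[OF A B])
    then show "c \<in> col_space A"
      using A B j by (auto simp: col_space_eq[OF A])
  qed
  then have sub: "span (set (cols (A * B))) \<subseteq> span (set (cols A))"
    unfolding col_space_def by (rule span_is_subset[OF _ span_is_submodule]) (use cA in auto)
  have sA: "subspace class_ring (span (set (cols A))) V"
    and sAB: "subspace class_ring (span (set (cols (A * B)))) V"
    using span_is_subspace cA cAB by auto
  interpret W: vectorspace class_ring "span_vs (set (cols A))"
    using sA subspace_is_vs by simp
  have AB: "A * B \<in> carrier_mat n k" using A B by simp
  have "rank (A * B) \<le> rank A"
    unfolding rank_def
    using W.subspace_dim[OF nested_subspaces[OF sA sAB sub] fin_dim_span_cols[OF A]]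
      fin_dim_span_cols[OF AB] by simp
  then show ?thesis using rank_le_nc[OF A] by simp
qed

text \<open>A maximal independent set \<open>U\<close> of columns spans all columns, since a column
  outside its span could be added to it. \<open>A\<close> lists \<open>U\<close>, and
  \<open>B\<close> holds the coordinates of the columns of \<open>X\<close> with respect to
  \<open>U\<close>.\<close>

lemma (in vec_space) rank_factorization:
  assumes X: "X \<in> carrier_mat n k"
  obtains A B where "A \<in> carrier_mat n (rank X)" "B \<in> carrier_mat (rank X) k" "X = A * B"
proof -
  obtain U where U: "maximal U (\<lambda>T. T \<subseteq> set (cols X) \<and> lin_indpt T)" "finite U"
    using maximal_exists_superset[of "set (cols X)" "\<lambda>T. T \<subseteq> set (cols X) \<and> lin_indpt T" "{}"]
      finite_lin_indpt2 by (auto simp: lin_dep_def)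
  have r: "rank X = card U" using rank_card_indpt[OF X U(1)] .
  have US: "U \<subseteq> set (cols X)" and ind: "lin_indpt U"
    using U(1) by (auto simp: maximal_def)
  have cX: "set (cols X) \<subseteq> carrier_vec n" using X by (auto simp: cols_def)
  have UV: "U \<subseteq> carrier_vec n" using US cX by blast
  have span: "c \<in> span U" if c: "c \<in> set (cols X)" for c
  proof (rule ccontr)
    assume nin: "c \<notin> span U"
    then have nU: "c \<notin> U" using span_mem UV by auto
    have "lin_indpt (U \<union> {c})"
      using lin_dep_iff_in_span[of U c] UV ind cX c nU nin by auto
    moreover have "U \<union> {c} \<subseteq> set (cols X)" using US c by auto
    ultimately have "U \<union> {c} = U" using U(1) unfolding maximal_def by blast
    with nU show False by auto
  qed
  obtain us where us: "set us = U" "distinct us" using finite_distinct_list[OF U(2)] by blast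
  have len: "length us = rank X" using us r distinct_card by fastforce
  define A where "A = mat_of_cols n us"
  have A: "A \<in> carrier_mat n (rank X)" and colsA: "cols A = us"
    unfolding A_def using len us UV by auto
  have "\<exists>v\<in>carrier_vec (rank X). A *\<^sub>v v = col X j" if "j < k" for j
  proof -
    have "col X j \<in> set (cols X)" using X that by (auto simp: cols_def)
    then have "col X j \<in> col_space A" using span us colsA by (simp add: col_space_def)
    then show ?thesis using A unfolding col_space_eq[OF A] by auto
  qed
  then obtain v where v: "\<And>j. j < k \<Longrightarrow> v j \<in> carrier_vec (rank X) \<and> A *\<^sub>v v j = col X j"
    by metis
  define B where "B = mat (rank X) k (\<lambda>(i, j). v j $ i)"
  have B: "B \<in> carrier_mat (rank X) k" by (simp add: B_def)
  have colB: "col B j = v j" if "j < k" for j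
    using v[OF that] that by (intro eq_vecI) (auto simp: B_def)
  have "X = A * B"
  proof (rule mat_col_eqI)
    fix j assume "j < dim_col (A * B)"
    then have j: "j < k" using B by simp
    have "col (A * B) j = A *\<^sub>v col B j" by (rule col_mult2[OF A B j])
    then show "col X j = col (A * B) j" using colB[OF j] v[OF j] by simp
  qed (use X A B in auto)
  then show thesis using that A B by blast
qed

section \<open>Linear systems over a finite field\<close>

lemma
  assumes "finite (UNIV :: 'a set)"
  shows finite_carrier_mat: "finite (carrier_mat m n :: 'a mat set)"
    and card_carrier_mat: "card (carrier_mat m n :: 'a mat set) = card (UNIV :: 'a set) ^ (m * n)"
proof -
  let ?I = "{..<m} \<times> {..<n}"
  let ?F = "PiE ?I (\<lambda>_. UNIV :: 'a set)"
  have bij: "bij_betw (\<lambda>f. mat m n f) ?F (carrier_mat m n)"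
  proof (rule bij_betw_byWitness[where f' = "\<lambda>A. restrict (\<lambda>ij. A $$ ij) ?I"])
    show "\<forall>f\<in>?F. restrict (\<lambda>ij. mat m n f $$ ij) ?I = f"
      by (auto intro!: PiE_ext[of _ ?I "\<lambda>_. UNIV"])
  qed (auto split: if_splits)
  have fin: "finite ?F" using assms by (intro finite_PiE) auto
  show "finite (carrier_mat m n :: 'a mat set)"
    using bij_betw_finite[OF bij] fin by simp
  show "card (carrier_mat m n :: 'a mat set) = card (UNIV :: 'a set) ^ (m * n)"
    using bij_betw_same_card[OF bij] by (simp add: card_PiE)
qed

text \<open>The fibres of \<open>Y \<mapsto> Y * D\<close> are translates of each other along the right inverse
  \<open>M \<mapsto> M * L\<close>.\<close>

lemma card_left_solutions:
  fixes D :: "'a::field mat"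
  assumes fin: "finite (UNIV :: 'a set)"
    and L: "L \<in> carrier_mat t n" and D: "D \<in> carrier_mat n t" and LD: "L * D = 1\<^sub>m t"
    and b: "b \<in> carrier_mat k t"
  shows "card {Y \<in> carrier_mat k n. Y * D = b} * card (UNIV :: 'a set) ^ (k * t)
    = card (UNIV :: 'a set) ^ (k * n)"
proof -
  let ?S = "{Y \<in> carrier_mat k n. Y * D = b}"
  \<comment> \<open>Since \<open>L * D\<close> is the identity, adding \<open>M * L\<close> changes
    the value of \<open>Y * D\<close> by exactly \<open>M\<close>. Hence the defect
    \<open>Z * D - b\<close> recovers \<open>M\<close>, and subtracting its lift recovers the
    solution \<open>Y\<close>.\<close>
  have "bij_betw (\<lambda>(Y, M). Y + M * L) (?S \<times> carrier_mat k t) (carrier_mat k n)"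
  proof (rule bij_betw_byWitness[where f' = "\<lambda>Z. (Z - (Z * D - b) * L, Z * D - b)"])
    have MD: "M * L * D = M" if "M \<in> carrier_mat k t" for M
      using that LD by (simp add: assoc_mult_mat[OF that L D])
    have 1: "(Y + M * L) * D - b = M" if "Y \<in> ?S" "M \<in> carrier_mat k t" for Y M
    proof -
      have "(Y + M * L) * D = b + M"
        using that L D MD[OF that(2)] by (subst add_mult_distrib_mat[of _ k n]) auto
      moreover have "b + M - b = M" using b that(2) by (intro eq_matI) auto
      ultimately show ?thesis by simp
    qed
    have cancel: "X + W - W = X" "X - W + W = X"
      if "X \<in> carrier_mat k n" "W \<in> carrier_mat k n" for X W :: "'a mat"
      using that by (intro eq_matI; simp)+
    show "\<forall>p\<in>?S \<times> carrier_mat k t. (\<lambda>Z. (Z - (Z * D - b) * L, Z * D - b))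
        ((\<lambda>(Y, M). Y + M * L) p) = p"
    proof
      fix p :: "'a mat \<times> 'a mat" assume "p \<in> ?S \<times> carrier_mat k t"
      then obtain Y M where p: "p = (Y, M)" and YM: "Y \<in> ?S" "M \<in> carrier_mat k t"
        by blast
      have "Y \<in> carrier_mat k n" "M * L \<in> carrier_mat k n" using YM L by auto
      then show "(\<lambda>Z. (Z - (Z * D - b) * L, Z * D - b)) ((\<lambda>(Y, M). Y + M * L) p) = p"
        unfolding p using 1[OF YM] cancel(1) by simp
    qed
    show "\<forall>Z\<in>carrier_mat k n. (\<lambda>(Y, M). Y + M * L) (Z - (Z * D - b) * L, Z * D - b) = Z"
      using cancel(2)[OF _ mult_carrier_mat[OF minus_carrier_mat[OF b] L]] by simp
    show "(\<lambda>(Y, M). Y + M * L) ` (?S \<times> carrier_mat k t) \<subseteq> carrier_mat k n"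
      using L by auto
    have "(Z - (Z * D - b) * L) * D = b" if "Z \<in> carrier_mat k n" for Z
    proof -
      have W: "Z * D - b \<in> carrier_mat k t" by (rule minus_carrier_mat[OF b])
      have "(Z - (Z * D - b) * L) * D = Z * D - (Z * D - b)"
        using minus_mult_distrib_mat[OF that mult_carrier_mat[OF W L] D] MD[OF W] by simp
      also have "\<dots> = b" using that D b by (intro eq_matI) auto
      finally show ?thesis .
    qed
    then show "(\<lambda>Z. (Z - (Z * D - b) * L, Z * D - b)) ` carrier_mat k n \<subseteq> ?S \<times> carrier_mat k t"
      using L b D by auto
  qed
  from bij_betw_same_card[OF this] show ?thesis
    by (simp add: card_cartesian_product card_carrier_mat[OF fin])
qed

text \<open>Transposition turns the system into a homogeneous left system, and the right inverse
  \<open>R\<close> of \<open>C\<close> into a left inverse. The product form avoids the truncated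
  difference \<open>n - t\<close> in an exponent.\<close>

lemma card_right_kernel:
  fixes C :: "'a::field mat"
  assumes fin: "finite (UNIV :: 'a set)"
    and C: "C \<in> carrier_mat t n" and R: "R \<in> carrier_mat n t" and CR: "C * R = 1\<^sub>m t"
  shows "card {X \<in> carrier_mat n k. C * X = 0\<^sub>m t k} * card (UNIV :: 'a set) ^ (k * t)
    = card (UNIV :: 'a set) ^ (k * n)"
proof -
  have tr: "transpose_mat X * transpose_mat C = transpose_mat (C * X)" if "X \<in> carrier_mat n k" for X
    using transpose_mult[OF C that] by simp
  have "bij_betw transpose_mat {X \<in> carrier_mat n k. C * X = 0\<^sub>m t k}
      {Y \<in> carrier_mat k n. Y * transpose_mat C = 0\<^sub>m k t}"
  proof (rule bij_betw_byWitness[where f' = transpose_mat])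
    show "transpose_mat ` {X \<in> carrier_mat n k. C * X = 0\<^sub>m t k}
        \<subseteq> {Y \<in> carrier_mat k n. Y * transpose_mat C = 0\<^sub>m k t}"
      using tr by auto
    show "transpose_mat ` {Y \<in> carrier_mat k n. Y * transpose_mat C = 0\<^sub>m k t}
        \<subseteq> {X \<in> carrier_mat n k. C * X = 0\<^sub>m t k}"
    proof safe
      fix Y assume Y: "Y \<in> carrier_mat k n" "Y * transpose_mat C = 0\<^sub>m k t"
      then show "transpose_mat Y \<in> carrier_mat n k" by simp
      have "C * transpose_mat Y = transpose_mat (Y * transpose_mat C)"
        using transpose_mult[OF Y(1), of "transpose_mat C" t] C by simp
      then show "C * transpose_mat Y = 0\<^sub>m t k" using Y by simp
    qed
  qed auto
  moreover have "transpose_mat R * transpose_mat C = 1\<^sub>m t"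
    using transpose_mult[OF C R] CR by simp
  ultimately show ?thesis
    using card_left_solutions[OF fin, of "transpose_mat R" t n "transpose_mat C" "0\<^sub>m k t" k] C R
    by (auto dest: bij_betw_same_card)
qed

section \<open>Pairs with \<open>B J A = I\<^sub>s\<close>\<close>

text \<open>For \<open>m = n = s\<close> and \<open>J\<close> the identity these are the pairs of
  mutually inverse matrices, hence a copy of the general linear group of degree
  \<open>s\<close>.\<close>

definition dual_pairs :: "nat \<Rightarrow> nat \<Rightarrow> 'a::field mat \<Rightarrow> nat \<Rightarrow> ('a mat \<times> 'a mat) set" where
  "dual_pairs m n J s =
    {(A, B). A \<in> carrier_mat m s \<and> B \<in> carrier_mat s n \<and> B * J * A = 1\<^sub>m s}"

text \<open>The columns \<open>x\<close> and rows \<open>y\<close> by which a pair can be enlarged: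
  the three equations prescribe the blocks of the enlarged product that involve \<open>x\<close> or
  \<open>y\<close>.\<close>

definition dual_ext ::
    "nat \<Rightarrow> nat \<Rightarrow> 'a::field mat \<Rightarrow> nat \<Rightarrow> 'a mat \<times> 'a mat \<Rightarrow> ('a mat \<times> 'a mat) set" where
  "dual_ext m n J s = (\<lambda>(A, B). {(x, y). x \<in> carrier_mat m 1 \<and> y \<in> carrier_mat 1 n \<and>
    B * J * x = 0\<^sub>m s 1 \<and> y * J * A = 0\<^sub>m 1 s \<and> y * J * x = 1\<^sub>m 1})"

section \<open>Joining columns and rows as degenerate block matrices\<close>

definition join_cols :: "'a::zero mat \<Rightarrow> 'a mat \<Rightarrow> 'a mat" where
  "join_cols A x = four_block_mat A x (0\<^sub>m 0 (dim_col A)) (0\<^sub>m 0 (dim_col x))"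

lemma join_cols_carrier [simp]:
  "A \<in> carrier_mat m s \<Longrightarrow> x \<in> carrier_mat m t \<Longrightarrow> join_cols A x \<in> carrier_mat m (s + t)"
  unfolding join_cols_def by (auto intro!: carrier_matI)

lemma append_rows_carrier [simp]:
  "B \<in> carrier_mat s n \<Longrightarrow> y \<in> carrier_mat t n \<Longrightarrow> B @\<^sub>r y \<in> carrier_mat (s + t) n"
  unfolding append_rows_def by (auto intro!: carrier_matI)

lemma four_block_mat_inj:
  assumes "A \<in> carrier_mat a c" "B \<in> carrier_mat a d" "C \<in> carrier_mat b c" "D \<in> carrier_mat b d"
    and "A' \<in> carrier_mat a c" "B' \<in> carrier_mat a d" "C' \<in> carrier_mat b c" "D' \<in> carrier_mat b d"
  shows "four_block_mat A B C D = four_block_mat A' B' C' D'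
    \<longleftrightarrow> A = A' \<and> B = B' \<and> C = C' \<and> D = D'" (is "?M = ?M' \<longleftrightarrow> _")
proof
  assume eq: "?M = ?M'"
  have entry: "?M $$ (i, j) = ?M' $$ (i, j)" for i j
    using eq by simp
  have "A = A'"
  proof (rule eq_matI)
    show "A $$ (i, j) = A' $$ (i, j)" if "i < dim_row A'" "j < dim_col A'" for i j
      using that entry[of i j] assms by auto
  qed (use assms in auto)
  moreover have "B = B'"
  proof (rule eq_matI)
    show "B $$ (i, j) = B' $$ (i, j)" if "i < dim_row B'" "j < dim_col B'" for i j
      using that entry[of i "j + c"] assms by auto
  qed (use assms in auto)
  moreover have "C = C'"
  proof (rule eq_matI)
    show "C $$ (i, j) = C' $$ (i, j)" if "i < dim_row C'" "j < dim_col C'" for i j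
      using that entry[of "i + a" j] assms by auto
  qed (use assms in auto)
  moreover have "D = D'"
  proof (rule eq_matI)
    show "D $$ (i, j) = D' $$ (i, j)" if "i < dim_row D'" "j < dim_col D'" for i j
      using that entry[of "i + a" "j + c"] assms by auto
  qed (use assms in auto)
  ultimately show "A = A' \<and> B = B' \<and> C = C' \<and> D = D'" by simp
qed auto

lemma join_cols_inj:
  assumes "A \<in> carrier_mat m s" "A' \<in> carrier_mat m s" "x \<in> carrier_mat m t" "x' \<in> carrier_mat m t"
  shows "join_cols A x = join_cols A' x' \<longleftrightarrow> A = A' \<and> x = x'"
  using assms four_block_mat_inj[of A m s x t "0\<^sub>m 0 s" 0 "0\<^sub>m 0 t" A' x' "0\<^sub>m 0 s" "0\<^sub>m 0 t"]
  by (auto simp: join_cols_def)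

lemma append_rows_inj:
  assumes "A \<in> carrier_mat s n" "A' \<in> carrier_mat s n" "x \<in> carrier_mat t n" "x' \<in> carrier_mat t n"
  shows "A @\<^sub>r x = A' @\<^sub>r x' \<longleftrightarrow> A = A' \<and> x = x'"
  using assms four_block_mat_inj[of A s n "0\<^sub>m s 0" 0 x t "0\<^sub>m t 0" A' "0\<^sub>m s 0" x' "0\<^sub>m t 0"]
  by (auto simp: append_rows_def)

lemma join_cols_surj:
  assumes "M \<in> carrier_mat m (s + t)"
  obtains A x where "A \<in> carrier_mat m s" "x \<in> carrier_mat m t" "M = join_cols A x"
proof -
  obtain A x C D where sb: "split_block M m s = (A, x, C, D)"
    by (cases "split_block M m s") auto
  \<comment> \<open>The summand \<open>0\<close> makes the two lower blocks of the splitting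
    empty.\<close>
  have "dim_row M = m + 0" "dim_col M = s + t" using assms by auto
  note * = split_block[OF sb this]
  have "C = 0\<^sub>m 0 s" "D = 0\<^sub>m 0 t" using * by (auto intro!: eq_matI)
  then show thesis using that[of A x] * by (simp add: join_cols_def)
qed

lemma append_rows_surj:
  assumes "M \<in> carrier_mat (s + t) n"
  obtains B y where "B \<in> carrier_mat s n" "y \<in> carrier_mat t n" "M = B @\<^sub>r y"
proof -
  obtain A x C D where sb: "split_block M s n = (A, x, C, D)"
    by (cases "split_block M s n") auto
  have "dim_row M = s + t" "dim_col M = n + 0" using assms by auto
  note * = split_block[OF sb this]
  have "x = 0\<^sub>m s 0" "D = 0\<^sub>m t 0" using * by (auto intro!: eq_matI)
  then show thesis using that[of A C] * by (simp add: append_rows_def)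
qed

lemma mult_join_cols:
  assumes "M \<in> carrier_mat k m" "A \<in> carrier_mat m s" "x \<in> carrier_mat m t"
  shows "M * join_cols A x = join_cols (M * A) (M * x)"
  using assms by (auto intro!: mat_col_eqI eq_vecI simp: join_cols_def scalar_prod_def)

lemma append_rows_mult:
  assumes B: "B \<in> carrier_mat s n" and y: "y \<in> carrier_mat t n" and M: "M \<in> carrier_mat n k"
  shows "(B @\<^sub>r y) * M = (B * M) @\<^sub>r (y * M)"
  using assms by (auto intro!: eq_matI simp: append_rows_def scalar_prod_def)

lemma append_rows_mult_join_cols:
  assumes B: "B \<in> carrier_mat s n" and y: "y \<in> carrier_mat t n"
    and A: "A \<in> carrier_mat n u" and x: "x \<in> carrier_mat n v"
  shows "(B @\<^sub>r y) * join_cols A x = four_block_mat (B * A) (B * x) (y * A) (y * x)"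
  using assms unfolding append_rows_def join_cols_def
  by (subst mult_four_block_mat[of _ s n _ 0 _ t _ _ u _ v]) auto

text \<open>The product for the enlarged pair is a 2 by 2 block matrix. Comparing it with the
  identity block by block gives the condition on \<open>(A, B)\<close> together with the three
  conditions of \<open>dual_ext\<close>; splitting off the last column and the last row inverts the
  map.\<close>

lemma dual_pairs_Suc:
  fixes J :: "'a::field mat"
  assumes J: "J \<in> carrier_mat n m"
  shows "bij_betw (\<lambda>((A, B), (x, y)). (join_cols A x, B @\<^sub>r y))
    (SIGMA p:dual_pairs m n J s. dual_ext m n J s p) (dual_pairs m n J (Suc s))"
proof -
  have iff: "(join_cols A x, B @\<^sub>r y) \<in> dual_pairs m n J (Suc s)
      \<longleftrightarrow> (A, B) \<in> dual_pairs m n J s \<and> (x, y) \<in> dual_ext m n J s (A, B)"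
    if c: "A \<in> carrier_mat m s" "x \<in> carrier_mat m 1" "B \<in> carrier_mat s n" "y \<in> carrier_mat 1 n"
    for A B x y
  proof -
    have "(B @\<^sub>r y) * J = (B * J) @\<^sub>r (y * J)" using c J by (intro append_rows_mult)
    then have "(B @\<^sub>r y) * J * join_cols A x
        = four_block_mat (B * J * A) (B * J * x) (y * J * A) (y * J * x)"
      using c J append_rows_mult_join_cols[of "B * J" s m "y * J" 1 A s x 1] by simp
    moreover have "1\<^sub>m (Suc s) = four_block_mat (1\<^sub>m s) (0\<^sub>m s 1) (0\<^sub>m 1 s) (1\<^sub>m 1 :: 'a mat)"
      using four_block_one_mat[of s 1] by simp
    moreover have "four_block_mat (B * J * A) (B * J * x) (y * J * A) (y * J * x)
        = four_block_mat (1\<^sub>m s) (0\<^sub>m s 1) (0\<^sub>m 1 s) (1\<^sub>m 1) \<longleftrightarrow>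
        B * J * A = 1\<^sub>m s \<and> B * J * x = 0\<^sub>m s 1 \<and> y * J * A = 0\<^sub>m 1 s \<and> y * J * x = 1\<^sub>m 1"
      by (rule four_block_mat_inj[where a = s and b = 1 and c = s and d = 1]) (use c J in auto)
    ultimately have "(B @\<^sub>r y) * J * join_cols A x = 1\<^sub>m (Suc s) \<longleftrightarrow>
        B * J * A = 1\<^sub>m s \<and> B * J * x = 0\<^sub>m s 1 \<and> y * J * A = 0\<^sub>m 1 s \<and> y * J * x = 1\<^sub>m 1"
      by (simp only:)
    moreover have "join_cols A x \<in> carrier_mat m (Suc s)" "B @\<^sub>r y \<in> carrier_mat (Suc s) n"
      using join_cols_carrier[OF c(1,2)] append_rows_carrier[OF c(3,4)] by auto
    ultimately show ?thesis using c by (auto simp: dual_pairs_def dual_ext_def)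
  qed
  show ?thesis
    unfolding bij_betw_def
  proof
    show "inj_on (\<lambda>((A, B), (x, y)). (join_cols A x, B @\<^sub>r y))
        (SIGMA p:dual_pairs m n J s. dual_ext m n J s p)"
      by (auto simp: inj_on_def dual_pairs_def dual_ext_def
        join_cols_inj[of _ m s _ _ 1] append_rows_inj[of _ s n _ _ 1])
    show "(\<lambda>((A, B), (x, y)). (join_cols A x, B @\<^sub>r y)) `
        (SIGMA p:dual_pairs m n J s. dual_ext m n J s p) = dual_pairs m n J (Suc s)"
    proof (intro equalityI subsetI)
      fix p assume "p \<in> (\<lambda>((A, B), (x, y)). (join_cols A x, B @\<^sub>r y)) `
        (SIGMA p:dual_pairs m n J s. dual_ext m n J s p)"
      then obtain A B x y where *: "(A, B) \<in> dual_pairs m n J s"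
          "(x, y) \<in> dual_ext m n J s (A, B)" "p = (join_cols A x, B @\<^sub>r y)"
        by auto
      then show "p \<in> dual_pairs m n J (Suc s)"
        using iff[of A x B y] by (simp add: dual_pairs_def dual_ext_def)
    next
      fix p assume p: "p \<in> dual_pairs m n J (Suc s)"
      then have "fst p \<in> carrier_mat m (s + 1)" "snd p \<in> carrier_mat (s + 1) n"
        by (auto simp: dual_pairs_def)
      then obtain A x B y where *: "A \<in> carrier_mat m s" "x \<in> carrier_mat m 1" "fst p = join_cols A x"
        "B \<in> carrier_mat s n" "y \<in> carrier_mat 1 n" "snd p = B @\<^sub>r y"
        by (metis join_cols_surj append_rows_surj)
      then have "p = (join_cols A x, B @\<^sub>r y)" by (cases p) auto
      then show "p \<in> (\<lambda>((A, B), (x, y)). (join_cols A x, B @\<^sub>r y)) `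
        (SIGMA p:dual_pairs m n J s. dual_ext m n J s p)"
        using p iff[OF *(1,2,4,5)] by force
    qed
  qed
qed

section \<open>Counting the extensions of a pair, and then the pairs\<close>

lemma finite_dual_pairs:
  assumes "finite (UNIV :: 'a::field set)"
  shows "finite (dual_pairs m n (J :: 'a mat) s)"
  by (rule finite_subset[of _ "carrier_mat m s \<times> carrier_mat s n"])
    (auto simp: dual_pairs_def finite_carrier_mat[OF assms])

lemma column_left_inverse:
  fixes v :: "'a::field mat"
  assumes v: "v \<in> carrier_mat n 1" and v0: "v \<noteq> 0\<^sub>m n 1"
  obtains z where "z \<in> carrier_mat 1 n" "z * v = 1\<^sub>m 1"
proof -
  have "\<exists>i<n. v $$ (i, 0) \<noteq> 0"
  proof (rule ccontr)
    assume "\<not> ?thesis"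
    then have "v = 0\<^sub>m n 1" using v by (intro eq_matI) auto
    with v0 show False by simp
  qed
  then obtain i where i: "i < n" "v $$ (i, 0) \<noteq> 0" by blast
  \<comment> \<open>The unit row at position \<open>i\<close>, scaled by the inverse of the nonzero
    entry that it picks out.\<close>
  define z where "z = mat 1 n (\<lambda>(_, j). if j = i then 1 / v $$ (i, 0) else 0)"
  have z: "z \<in> carrier_mat 1 n" by (simp add: z_def)
  have "(z * v) $$ (0, 0) = (\<Sum>j<n. z $$ (0, j) * v $$ (j, 0))"
    using z v by (simp add: times_mat_def scalar_prod_def atLeast0LessThan)
  also have "\<dots> = (\<Sum>j<n. if j = i then 1 else 0)"
    using i by (intro sum.cong) (auto simp: z_def)
  finally have "(z * v) $$ (0, 0) = 1" using i by simp
  then have "z * v = 1\<^sub>m 1"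
    using z v by (intro eq_matI) (auto simp del: index_mult_mat(1))
  with z show thesis by (rule that)
qed

text \<open>\<open>J = U * V\<close> is a full rank factorization, so \<open>J\<close> has rank
  \<open>r\<close> and the same kernel as \<open>V\<close>. The first factor counts the columns
  \<open>x\<close>, the second the rows \<open>y\<close> belonging to a fixed \<open>x\<close>.
  Rational quotients of powers replace differences of exponents.\<close>

lemma card_dual_ext:
  fixes J :: "'a::field mat"
  assumes fin: "finite (UNIV :: 'a set)" and q: "Q = rat_of_nat (card (UNIV :: 'a set))"
    and U: "U \<in> carrier_mat n r" "U' \<in> carrier_mat r n" "U' * U = 1\<^sub>m r"
    and V: "V \<in> carrier_mat r m" "V' \<in> carrier_mat m r" "V * V' = 1\<^sub>m r"
    and J: "J = U * V"
    and p: "(A, B) \<in> dual_pairs m n J s"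
  shows "rat_of_nat (card (dual_ext m n J s (A, B)))
    = (Q ^ m / Q ^ s - Q ^ m / Q ^ r) * (Q ^ n / Q ^ Suc s)"
proof -
  have Jc: "J \<in> carrier_mat n m" using U V J by simp
  have A: "A \<in> carrier_mat m s" and B: "B \<in> carrier_mat s n" and BJA: "B * J * A = 1\<^sub>m s"
    using p by (auto simp: dual_pairs_def)
  have Q0: "Q \<noteq> 0" using fin q by simp
  \<comment> \<open>The left inverse \<open>U'\<close> removes \<open>U\<close>, so that
    \<open>J\<close> and \<open>V\<close> annihilate the same columns.\<close>
  have J0: "J * x = 0\<^sub>m n 1 \<longleftrightarrow> V * x = 0\<^sub>m r 1" if x: "x \<in> carrier_mat m 1" for x
  proof
    assume "J * x = 0\<^sub>m n 1"
    then have "U' * (J * x) = 0\<^sub>m r 1" using U by simp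
    moreover have "U' * (J * x) = U' * U * (V * x)"
      unfolding J assoc_mult_mat[OF U(1) V(1) x]
      by (rule assoc_mult_mat[symmetric]) (use U V x in auto)
    ultimately show "V * x = 0\<^sub>m r 1" using U(3) V(1) x by simp
  next
    assume "V * x = 0\<^sub>m r 1"
    then show "J * x = 0\<^sub>m n 1" using U V x by (simp add: J mult_assoc_dim)
  qed
  let ?K = "{x \<in> carrier_mat m 1. B * J * x = 0\<^sub>m s 1}"
  let ?N = "{x \<in> carrier_mat m 1. V * x = 0\<^sub>m r 1}"
  have finc: "finite (carrier_mat a b :: 'a mat set)" for a b
    by (rule finite_carrier_mat[OF fin])
  have sub: "?N \<subseteq> ?K"
  proof
    fix x assume "x \<in> ?N"
    then have x: "x \<in> carrier_mat m 1" "V * x = 0\<^sub>m r 1" by auto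
    then have "J * x = 0\<^sub>m n 1" using J0 by blast
    then have "B * (J * x) = 0\<^sub>m s 1" using B by simp
    then show "x \<in> ?K" using x(1) B Jc by simp
  qed
  \<comment> \<open>The condition \<open>B * J * A = 1\<^sub>m s\<close> says that \<open>A\<close>
    is a right inverse of \<open>B * J\<close>.\<close>
  have "rat_of_nat (card ?K) * Q ^ s = Q ^ m"
    using card_right_kernel[OF fin, of "B * J" s m A 1] A B Jc BJA
    unfolding q of_nat_power[symmetric] of_nat_mult[symmetric] by simp
  moreover have "rat_of_nat (card ?N) * Q ^ r = Q ^ m"
    using card_right_kernel[OF fin V, of 1]
    unfolding q of_nat_power[symmetric] of_nat_mult[symmetric] by simp
  moreover have "card (?K - ?N) = card ?K - card ?N" "card ?N \<le> card ?K"
    using finc sub by (auto intro!: card_Diff_subset card_mono intro: finite_subset)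
  ultimately have cK: "rat_of_nat (card (?K - ?N)) = Q ^ m / Q ^ s - Q ^ m / Q ^ r"
    using Q0 by (simp add: of_nat_diff field_simps)
  let ?Y = "\<lambda>x. {y \<in> carrier_mat 1 n. y * J * A = 0\<^sub>m 1 s \<and> y * J * x = 1\<^sub>m 1}"
  \<comment> \<open>The equation \<open>y * J * x = 1\<^sub>m 1\<close> forces \<open>J * x\<close>
    to be nonzero, which excludes exactly the columns in \<open>?N\<close>.\<close>
  have ext: "dual_ext m n J s (A, B) = (SIGMA x:?K - ?N. ?Y x)"
  proof -
    have "J * x \<noteq> 0\<^sub>m n 1" if "y * J * x = 1\<^sub>m 1" "x \<in> carrier_mat m 1" "y \<in> carrier_mat 1 n" for x y
    proof
      assume "J * x = 0\<^sub>m n 1"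
      then have "y * J * x = 0\<^sub>m 1 1" using that Jc by (simp add: mult_assoc_dim)
      then have "1\<^sub>m 1 $$ (0, 0) = (0\<^sub>m 1 1 :: 'a mat) $$ (0, 0)" using that by simp
      then show False by simp
    qed
    then show ?thesis using J0 by (auto simp: dual_ext_def)
  qed
  have cY: "rat_of_nat (card (?Y x)) = Q ^ n / Q ^ Suc s" if x: "x \<in> ?K - ?N" for x
  proof -
    have xc: "x \<in> carrier_mat m 1" and Bx: "B * J * x = 0\<^sub>m s 1" and Jx: "J * x \<noteq> 0\<^sub>m n 1"
      using x J0 by auto
    have Jxc: "J * x \<in> carrier_mat n 1" using Jc xc by simp
    obtain z where z: "z \<in> carrier_mat 1 n" and zx: "z * (J * x) = 1\<^sub>m 1"
      using column_left_inverse[OF Jxc Jx] .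
    have JA: "J * A \<in> carrier_mat n s" using Jc A by simp
    have BJA': "B * (J * A) = 1\<^sub>m s" and BJx': "B * (J * x) = 0\<^sub>m s 1"
      using BJA Bx assoc_mult_mat[OF B Jc A] assoc_mult_mat[OF B Jc xc] by auto
    define P where "P = z * (J * A)"
    have P: "P \<in> carrier_mat 1 s" unfolding P_def using z JA by (rule mult_carrier_mat)
    have PB: "P * B \<in> carrier_mat 1 n" using P B by (rule mult_carrier_mat)
    \<comment> \<open>Correcting \<open>z\<close> by a combination of the rows of \<open>B\<close>
      makes it vanish on \<open>J * A\<close>; its value on \<open>J * x\<close> stays 1 because
      \<open>B\<close> annihilates \<open>J * x\<close>.\<close>
    define w where "w = z - P * B"
    have w: "w \<in> carrier_mat 1 n" unfolding w_def using PB by (rule minus_carrier_mat)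
    have wA: "w * (J * A) = 0\<^sub>m 1 s"
      using minus_mult_distrib_mat[OF z PB JA] assoc_mult_mat[OF P B JA] BJA' P
      by (simp add: w_def P_def[symmetric])
    have wx: "w * (J * x) = 1\<^sub>m 1"
    proof -
      have "1\<^sub>m 1 - 0\<^sub>m 1 1 = (1\<^sub>m 1 :: 'a mat)" by (intro eq_matI) auto
      then show ?thesis
        using minus_mult_distrib_mat[OF z PB Jxc] assoc_mult_mat[OF P B Jxc] BJx' P zx
        by (simp add: w_def)
    qed
    \<comment> \<open>The \<open>s + 1\<close> equations for \<open>y\<close> form one system with
      coefficient matrix \<open>?D\<close>. Its left inverse \<open>?L\<close> shows that they are
      independent.\<close>
    let ?D = "join_cols (J * A) (J * x)" and ?L = "B @\<^sub>r w"
    have D: "?D \<in> carrier_mat n (s + 1)" by (rule join_cols_carrier[OF JA Jxc])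
    have L: "?L \<in> carrier_mat (s + 1) n" by (rule append_rows_carrier[OF B w])
    have "?L * ?D = four_block_mat (B * (J * A)) (B * (J * x)) (w * (J * A)) (w * (J * x))"
      by (rule append_rows_mult_join_cols[OF B w JA Jxc])
    then have LD: "?L * ?D = 1\<^sub>m (s + 1)" unfolding wA wx BJA' BJx' by simp
    have "?Y x = {y \<in> carrier_mat 1 n. y * ?D = join_cols (0\<^sub>m 1 s) (1\<^sub>m 1)}"
    proof -
      have "y * ?D = join_cols (0\<^sub>m 1 s) (1\<^sub>m 1) \<longleftrightarrow> y * J * A = 0\<^sub>m 1 s \<and> y * J * x = 1\<^sub>m 1"
        if y: "y \<in> carrier_mat 1 n" for y
      proof -
        have "y * J * A = y * (J * A)" "y * J * x = y * (J * x)"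
          using assoc_mult_mat[OF y Jc A] assoc_mult_mat[OF y Jc xc] by auto
        then show ?thesis
          unfolding mult_join_cols[OF y JA Jxc]
          using join_cols_inj[OF mult_carrier_mat[OF y JA] zero_carrier_mat
            mult_carrier_mat[OF y Jxc] one_carrier_mat] by simp
      qed
      then show ?thesis by blast
    qed
    moreover have "card {y \<in> carrier_mat 1 n. y * ?D = join_cols (0\<^sub>m 1 s) (1\<^sub>m 1)}
        * card (UNIV :: 'a set) ^ (1 * (s + 1)) = card (UNIV :: 'a set) ^ (1 * n)"
      by (rule card_left_solutions[OF fin L D LD
        join_cols_carrier[OF zero_carrier_mat one_carrier_mat]])
    ultimately have "rat_of_nat (card (?Y x)) * Q ^ Suc s = Q ^ n"
      unfolding q of_nat_power[symmetric] of_nat_mult[symmetric] by simp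
    then show ?thesis using Q0 by (simp add: field_simps)
  qed
  have "card (dual_ext m n J s (A, B)) = (\<Sum>x\<in>?K - ?N. card (?Y x))"
    unfolding ext using finc by (intro card_SigmaI) auto
  then have "rat_of_nat (card (dual_ext m n J s (A, B))) = (\<Sum>x\<in>?K - ?N. Q ^ n / Q ^ Suc s)"
    using cY by simp
  then show ?thesis using cK by simp
qed

text \<open>Induction on \<open>s\<close>: every pair has the same number of extensions, so each
  step contributes one factor. For \<open>s = 0\<close> there is just the pair of empty
  matrices.\<close>

lemma card_dual_pairs:
  fixes J :: "'a::field mat"
  assumes fin: "finite (UNIV :: 'a set)" and q: "Q = rat_of_nat (card (UNIV :: 'a set))"
    and U: "U \<in> carrier_mat n r" "U' \<in> carrier_mat r n" "U' * U = 1\<^sub>m r"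
    and V: "V \<in> carrier_mat r m" "V' \<in> carrier_mat m r" "V * V' = 1\<^sub>m r"
    and J: "J = U * V"
  shows "rat_of_nat (card (dual_pairs m n J s))
    = (\<Prod>i<s. (Q ^ m / Q ^ i - Q ^ m / Q ^ r) * (Q ^ n / Q ^ Suc i))"
proof (induction s)
  case 0
  have "dual_pairs m n J 0 = {(0\<^sub>m m 0, 0\<^sub>m 0 n)}"
    using U V J by (auto simp: dual_pairs_def intro!: eq_matI)
  then show ?case by simp
next
  case (Suc s)
  have fe: "finite (dual_ext m n J s p)" for p
    by (rule finite_subset[of _ "carrier_mat m 1 \<times> carrier_mat 1 n"])
      (auto simp: dual_ext_def finite_carrier_mat[OF fin])
  have "J \<in> carrier_mat n m" using U V J by simp
  from bij_betw_same_card[OF dual_pairs_Suc[OF this, of s]]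
  have "card (dual_pairs m n J (Suc s)) = (\<Sum>p\<in>dual_pairs m n J s. card (dual_ext m n J s p))"
    using fe by (simp add: finite_dual_pairs[OF fin] card_SigmaI)
  also have "rat_of_nat \<dots> = (\<Sum>p\<in>dual_pairs m n J s.
      (Q ^ m / Q ^ s - Q ^ m / Q ^ r) * (Q ^ n / Q ^ Suc s))"
    unfolding of_nat_sum
    by (rule sum.cong) (use card_dual_ext[OF fin q U V J] in auto)
  finally show ?case using Suc by (simp add: mult_ac)
qed

section \<open>Idempotents\<close>

lemma rank_one_mat: "vec_space.rank s (1\<^sub>m s :: 'a::field mat) = s"
  using vec_space.low_rank_det_zero[of "1\<^sub>m s :: 'a mat" s] by simp

text \<open>If \<open>B * J * A\<close> is the identity, it cancels in the middle of
  \<open>A * B * J * A * B\<close>, and the identity of size \<open>s\<close> factors through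
  \<open>X\<close>, which bounds the rank below. Conversely, a rank factorization of an idempotent
  is shown to be such a pair.\<close>

lemma dual_pairs_image:
  fixes J :: "'a::field mat"
  assumes J: "J \<in> carrier_mat n m"
  shows "(\<lambda>(A, B). A * B) ` dual_pairs m n J s
    = {X \<in> carrier_mat m n. X * J * X = X \<and> vec_space.rank m X = s}"
proof (intro equalityI subsetI)
  fix X assume "X \<in> (\<lambda>(A, B). A * B) ` dual_pairs m n J s"
  then obtain A B where A: "A \<in> carrier_mat m s" and B: "B \<in> carrier_mat s n"
    and BJA: "B * J * A = 1\<^sub>m s" and X: "X = A * B"
    by (auto simp: dual_pairs_def)
  have Xc: "X \<in> carrier_mat m n" using A B X by simp
  have BJ: "B * J \<in> carrier_mat s m" and JA: "J * A \<in> carrier_mat n s"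
    using A B J by auto
  have "X * J * X = A * (B * J * A) * B"
    using A B J by (simp add: X mult_assoc_dim)
  then have idem: "X * J * X = X" using A B by (simp only: BJA X) simp
  have "vec_space.rank m X \<le> s"
    unfolding X using vec_space.rank_mult_le[OF A B] .
  moreover have "s \<le> vec_space.rank m X"
  proof -
    obtain A' B' where A': "A' \<in> carrier_mat m (vec_space.rank m X)"
      and B': "B' \<in> carrier_mat (vec_space.rank m X) n" and X': "X = A' * B'"
      using vec_space.rank_factorization[OF Xc] .
    have "B * J * X * (J * A) = (B * J * A) * (B * J * A)"
      using A B J by (simp add: X mult_assoc_dim)
    then have "1\<^sub>m s = B * J * X * (J * A)" by (simp add: BJA)
    also have "\<dots> = (B * J * A') * (B' * (J * A))"
      using A A' B B' J by (simp add: X' mult_assoc_dim)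
    finally have "vec_space.rank s (1\<^sub>m s :: 'a mat) \<le> vec_space.rank m X"
      using vec_space.rank_mult_le[OF mult_carrier_mat[OF BJ A'] mult_carrier_mat[OF B' JA]] by simp
    then show ?thesis by (simp add: rank_one_mat)
  qed
  ultimately show "X \<in> {X \<in> carrier_mat m n. X * J * X = X \<and> vec_space.rank m X = s}"
    using Xc idem by simp
next
  fix X assume "X \<in> {X \<in> carrier_mat m n. X * J * X = X \<and> vec_space.rank m X = s}"
  then have Xc: "X \<in> carrier_mat m n" and idem: "X * J * X = X"
    and r: "vec_space.rank m X = s" by auto
  obtain A B where A: "A \<in> carrier_mat m s" and B: "B \<in> carrier_mat s n" and X: "X = A * B"
    using vec_space.rank_factorization[OF Xc] unfolding r .
  define M where "M = B * J * A"
  have BJ: "B * J \<in> carrier_mat s m" and JA: "J * A \<in> carrier_mat n s"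
    using A B J by auto
  have M: "M \<in> carrier_mat s s" unfolding M_def using BJ A by (rule mult_carrier_mat)
  have AMB: "A * M * B = X"
    using idem A B J by (simp add: X M_def mult_assoc_dim)
  \<comment> \<open>By \<open>A * M * B = X\<close>, a rank of \<open>M\<close> below
    \<open>s\<close> would push the rank of \<open>X\<close> below \<open>s\<close> as well.\<close>
  have det: "det M \<noteq> 0"
  proof
    assume "det M = 0"
    then have less: "vec_space.rank s M < s" using vec_space.det_zero_low_rank[OF M] by simp
    obtain C D where C: "C \<in> carrier_mat s (vec_space.rank s M)"
      and D: "D \<in> carrier_mat (vec_space.rank s M) s" and MCD: "M = C * D"
      using vec_space.rank_factorization[OF M] .
    have "A * M * B = (A * C) * (D * B)"
      unfolding MCD using A B C D by (simp add: mult_assoc_dim)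
    then have "vec_space.rank m X \<le> vec_space.rank s M"
      using vec_space.rank_mult_le[OF mult_carrier_mat[OF A C] mult_carrier_mat[OF D B]] AMB by simp
    with less r show False by simp
  qed
  \<comment> \<open>\<open>undefined\<close> only fills the record extension of
    \<open>ring_mat\<close>.\<close>
  from det_non_zero_imp_unit[OF M this, of undefined] obtain N where
    N: "N \<in> carrier_mat s s" and NM: "N * M = 1\<^sub>m s" and MN: "M * N = 1\<^sub>m s"
    by (auto simp: Units_def ring_mat_def)
  \<comment> \<open>Both sides are evaluated through \<open>A * M * B = X = A * B\<close>.
    Multiplying the resulting equation by \<open>N\<close> on the left and on the right then leaves
    \<open>M = 1\<^sub>m s\<close>.\<close>
  have "M * M * M = B * J * (A * M * B) * (J * A)"
    using A B J M by (simp add: M_def mult_assoc_dim)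
  also have "\<dots> = M * M"
    using A B J unfolding AMB by (simp add: X M_def mult_assoc_dim)
  finally have "N * (M * M * M) * N = N * (M * M) * N" by simp
  moreover have "N * (M * M * M) * N = (N * M) * M * (M * N)"
    using M N by (simp add: mult_assoc_dim)
  moreover have "N * (M * M) * N = (N * M) * (M * N)"
    using M N by (simp add: mult_assoc_dim)
  ultimately have "M = 1\<^sub>m s" using M by (simp add: NM MN)
  then have "(A, B) \<in> dual_pairs m n J s"
    using A B by (simp add: dual_pairs_def M_def)
  then show "X \<in> (\<lambda>(A, B). A * B) ` dual_pairs m n J s"
    using X by force
qed

text \<open>An invertible \<open>G\<close> with inverse \<open>H\<close> acts by changing the basis
  of the intermediate space. The identity \<open>B * J * A = 1\<^sub>m s\<close> recovers
  \<open>G\<close> as \<open>B * J * A'\<close> and \<open>H\<close> as \<open>B' * (J * A)\<close>,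
  so the action on a fibre is free and transitive.\<close>

lemma dual_pairs_fibre:
  fixes J :: "'a::field mat"
  assumes J: "J \<in> carrier_mat n m" and p: "(A, B) \<in> dual_pairs m n J s"
  shows "bij_betw (\<lambda>(G, H). (A * G, H * B)) (dual_pairs s s (1\<^sub>m s) s)
    {(A', B') \<in> dual_pairs m n J s. A' * B' = A * B}"
proof -
  have A: "A \<in> carrier_mat m s" and B: "B \<in> carrier_mat s n" and BJA: "B * J * A = 1\<^sub>m s"
    using p by (auto simp: dual_pairs_def)
  have GL: "(G, H) \<in> dual_pairs s s (1\<^sub>m s) s \<longleftrightarrow>
      G \<in> carrier_mat s s \<and> H \<in> carrier_mat s s \<and> H * G = 1\<^sub>m s" for G H :: "'a mat"
    by (auto simp: dual_pairs_def)
  have cancel_right: "B * J * (A * G) = G" if "G \<in> carrier_mat s k" for G k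
  proof -
    have "B * J * (A * G) = B * J * A * G" using that A B J by (simp add: mult_assoc_dim)
    then show ?thesis using that by (simp add: BJA)
  qed
  have cancel_left: "H * B * (J * A) = H" if "H \<in> carrier_mat k s" for H k
  proof -
    have "H * B * (J * A) = H * (B * J * A)" using that A B J by (simp add: mult_assoc_dim)
    then show ?thesis using that by (simp add: BJA)
  qed
  let ?F = "{(A', B') \<in> dual_pairs m n J s. A' * B' = A * B}"
  have to: "(A * G, H * B) \<in> ?F" if "(G, H) \<in> dual_pairs s s (1\<^sub>m s) s" for G H
  proof -
    have G: "G \<in> carrier_mat s s" and H: "H \<in> carrier_mat s s" and HG: "H * G = 1\<^sub>m s"
      using that GL by auto
    \<comment> \<open>The definition supplies \<open>H * G\<close>; the other order is what cancels
      in \<open>A * G * (H * B)\<close>.\<close>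
    have GH: "G * H = 1\<^sub>m s" using mat_mult_left_right_inverse[OF H G HG] .
    have "H * B * J * (A * G) = H * (B * J * (A * G))"
      using A B G H J by (simp add: mult_assoc_dim)
    then have "H * B * J * (A * G) = 1\<^sub>m s" by (simp only: cancel_right[OF G] HG)
    moreover have "A * G * (H * B) = A * (G * H) * B"
      using A B G H by (simp add: mult_assoc_dim)
    then have "A * G * (H * B) = A * B" using A by (simp only: GH) simp
    ultimately show ?thesis using A B G H by (simp add: dual_pairs_def)
  qed
  have from': "(B * J * A', B' * (J * A)) \<in> dual_pairs s s (1\<^sub>m s) s
      \<and> A * (B * J * A') = A' \<and> B' * (J * A) * B = B'"
    if "(A', B') \<in> ?F" for A' B'
  proof -
    have A': "A' \<in> carrier_mat m s" and B': "B' \<in> carrier_mat s n"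
      and BJA': "B' * J * A' = 1\<^sub>m s" and AB: "A' * B' = A * B"
      using that by (auto simp: dual_pairs_def)
    \<comment> \<open>Regrouping exposes \<open>A * B\<close>, which may be replaced by
      \<open>A' * B'\<close>; the identity for the primed pair then applies. The next two equations
      follow the same pattern.\<close>
    have "B' * (J * A) * (B * J * A') = B' * J * (A * B) * (J * A')"
      using A B A' B' J by (simp add: mult_assoc_dim)
    also have "\<dots> = (B' * J * A') * (B' * J * A')"
      using A' B' J by (simp add: AB[symmetric] mult_assoc_dim)
    finally have "B' * (J * A) * (B * J * A') = 1\<^sub>m s" by (simp add: BJA')
    moreover have "A * (B * J * A') = (A * B) * (J * A')"
      using A B A' J by (simp add: mult_assoc_dim)
    then have "A * (B * J * A') = A' * (B' * J * A')"
      using A' B' J by (simp add: AB[symmetric] mult_assoc_dim)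
    then have "A * (B * J * A') = A'" using A' by (simp add: BJA')
    moreover have "B' * (J * A) * B = B' * J * (A * B)"
      using A B B' J by (simp add: mult_assoc_dim)
    then have "B' * (J * A) * B = (B' * J * A') * B'"
      using A' B' J by (simp add: AB[symmetric] mult_assoc_dim)
    then have "B' * (J * A) * B = B'" using B' by (simp add: BJA')
    moreover have "B * J * A' \<in> carrier_mat s s" "B' * (J * A) \<in> carrier_mat s s"
      using A B A' B' J by (auto intro!: carrier_matI)
    ultimately show ?thesis using GL by blast
  qed
  show ?thesis
  proof (rule bij_betw_byWitness[where f' = "\<lambda>(A', B'). (B * J * A', B' * (J * A))"])
    show "\<forall>p\<in>dual_pairs s s (1\<^sub>m s) s. (\<lambda>(A', B'). (B * J * A', B' * (J * A)))
        ((\<lambda>(G, H). (A * G, H * B)) p) = p"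
    proof
      fix p :: "'a mat \<times> 'a mat" assume "p \<in> dual_pairs s s (1\<^sub>m s) s"
      then obtain G H where "p = (G, H)" "G \<in> carrier_mat s s" "H \<in> carrier_mat s s"
        by (auto simp: dual_pairs_def)
      then show "(\<lambda>(A', B'). (B * J * A', B' * (J * A))) ((\<lambda>(G, H). (A * G, H * B)) p) = p"
        by (simp only: prod.case cancel_left cancel_right)
    qed
    show "\<forall>p\<in>?F. (\<lambda>(G, H). (A * G, H * B)) ((\<lambda>(A', B'). (B * J * A', B' * (J * A))) p) = p"
    proof
      fix p assume "p \<in> ?F"
      then obtain A' B' where "p = (A', B')" "(A', B') \<in> ?F" by blast
      then show "(\<lambda>(G, H). (A * G, H * B)) ((\<lambda>(A', B'). (B * J * A', B' * (J * A))) p) = p"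
        using from' by (simp only: prod.case)
    qed
    show "(\<lambda>(G, H). (A * G, H * B)) ` dual_pairs s s (1\<^sub>m s) s \<subseteq> ?F"
      using to by fast
    show "(\<lambda>(A', B'). (B * J * A', B' * (J * A))) ` ?F \<subseteq> dual_pairs s s (1\<^sub>m s) s"
      using from' by fast
  qed
qed

text \<open>Double counting: the pairs are sorted by their product \<open>A * B\<close>, and each
  fibre has the size of the general linear group.\<close>

lemma card_idempotents_mult_card_GL:
  fixes J :: "'a::field mat"
  assumes fin: "finite (UNIV :: 'a set)" and J: "J \<in> carrier_mat n m"
  shows "card {X \<in> carrier_mat m n. X * J * X = X \<and> vec_space.rank m X = s}
      * card (dual_pairs s s (1\<^sub>m s :: 'a mat) s) = card (dual_pairs m n J s)"
proof -
  let ?f = "\<lambda>(A, B). A * B :: 'a mat"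
  let ?P = "dual_pairs m n J s"
  have "card ?P = (\<Sum>X\<in>?f ` ?P. card {p \<in> ?P. ?f p = X})"
    using sum.image_gen[of ?P "\<lambda>_. 1 :: nat" ?f] finite_dual_pairs[OF fin, of m n J s] by simp
  also have "\<dots> = (\<Sum>X\<in>?f ` ?P. card (dual_pairs s s (1\<^sub>m s :: 'a mat) s))"
  proof (rule sum.cong[OF refl])
    fix X assume "X \<in> ?f ` ?P"
    then obtain A B where p: "(A, B) \<in> ?P" "X = A * B" by auto
    have "{p \<in> ?P. ?f p = X} = {(A', B') \<in> ?P. A' * B' = A * B}" using p by auto
    then show "card {p \<in> ?P. ?f p = X} = card (dual_pairs s s (1\<^sub>m s :: 'a mat) s)"
      using bij_betw_same_card[OF dual_pairs_fibre[OF J p(1)]] by simp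
  qed
  finally show ?thesis by (simp add: dual_pairs_image[OF J])
qed

section \<open>Rectangular identity matrices and the factorization of \<open>J\<close>\<close>

definition delta_mat :: "nat \<Rightarrow> nat \<Rightarrow> 'a::zero_neq_one mat" where
  "delta_mat m n = mat m n (\<lambda>(i, j). if i = j then 1 else 0)"

lemma delta_mat_carrier [simp]: "delta_mat m n \<in> carrier_mat m n"
  by (simp add: delta_mat_def)

lemma delta_mat_mult:
  "delta_mat m k * delta_mat k n
    = (mat m n (\<lambda>(i, j). if i = j \<and> i < k then 1 else 0) :: 'a::semiring_1 mat)"
(is "_ = ?R")
proof (rule eq_matI)
  fix i j assume "i < dim_row ?R" "j < dim_col ?R"
  then have ij: "i < m" "j < n" by auto
  then have "(delta_mat m k * delta_mat k n) $$ (i, j)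
      = (\<Sum>l = 0..<k. (if i = l then 1 else 0) * (if l = j then 1 else 0 :: 'a))"
    by (simp add: delta_mat_def scalar_prod_def)
  also have "\<dots> = (\<Sum>l = 0..<k. if l = i then (if i = j then 1 else 0) else 0)"
    by (rule sum.cong) auto
  finally show "(delta_mat m k * delta_mat k n) $$ (i, j) = ?R $$ (i, j)"
    using ij by simp
qed (simp_all add: delta_mat_def)

lemma delta_mat_left_inverse: "r \<le> n \<Longrightarrow> delta_mat r n * delta_mat n r = (1\<^sub>m r :: 'a::semiring_1 mat)"
  unfolding delta_mat_mult by (rule eq_matI) auto

text \<open>Projection onto the first \<open>r\<close> coordinates followed by their inclusion: the
  full rank factorization that the count of pairs requires.\<close>

lemma J_mat_eq_delta_mat:
  assumes "r \<le> min m n"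
  shows "J_mat m n r = (delta_mat n r * delta_mat r m :: 'a::field mat)"
  unfolding delta_mat_mult J_mat_def using assms
  by (intro eq_matI) (auto simp: one_mat_def)

section \<open>The q-binomial coefficient as a quotient of the two counts\<close>

lemma q_fact_nonzero: "Q > (0 :: rat) \<Longrightarrow> q_fact Q k \<noteq> 0"
  unfolding q_fact_def
proof (rule prod_pos[THEN less_imp_neq, THEN not_sym])
  fix i assume "0 < Q" "i \<in> {1..k}"
  then show "0 < (\<Sum>j<i. Q ^ j)" by (intro sum_pos) (auto simp: lessThan_empty_iff)
qed

lemma q_fact_Suc: "q_fact Q (Suc k) = q_fact Q k * (\<Sum>j<Suc k. Q ^ j)"
  by (simp add: q_fact_def)

lemma q_binomial_eq_prod:
  fixes Q :: rat
  assumes Q: "Q > 1" and "s \<le> r"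
  shows "q_binomial Q r s = (\<Prod>i<s. (Q ^ (r - i) - 1) / (Q ^ (s - i) - 1))"
proof -
  \<comment> \<open>The top \<open>s\<close> factors of the q-factorial, each summed as a geometric
    series. It serves for \<open>k = r\<close> and for \<open>k = s\<close>; the denominators
    \<open>Q - 1\<close> cancel in the quotient.\<close>
  have falling: "q_fact Q k = q_fact Q (k - s) * (\<Prod>i<s. (Q ^ (k - i) - 1) / (Q - 1))"
    if "s \<le> k" for k s
    using that
  proof (induction s)
    case (Suc s)
    then have "k - s = Suc (k - Suc s)" by simp
    then have "q_fact Q (k - s) = q_fact Q (k - Suc s) * ((Q ^ (k - s) - 1) / (Q - 1))"
      using Q by (simp only: q_fact_Suc geometric_sum)
    then show ?case using Suc by simp
  qed simp
  have pos: "q_fact Q k \<noteq> 0" for k using q_fact_nonzero[of Q k] Q by simp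
  have "q_fact Q s = (\<Prod>i<s. (Q ^ (s - i) - 1) / (Q - 1))"
    using falling[of s s] by (simp add: q_fact_def)
  then have "q_binomial Q r s = (\<Prod>i<s. (Q ^ (r - i) - 1) / (Q - 1)) / (\<Prod>i<s. (Q ^ (s - i) - 1) / (Q - 1))"
    using falling[OF assms(2)] pos[of "r - s"] by (simp add: q_binomial_def)
  then show ?thesis using Q by (simp add: prod_dividef[symmetric])
qed

text \<open>Compares the \<open>i\<close>-th factor of the number of pairs with the
  \<open>i\<close>-th factor \<open>g\<close> of the order of the general linear group. Pulling out
  powers of \<open>Q\<close> leaves one factor of the q-binomial product and a power of
  \<open>Q\<close> that does not depend on \<open>i\<close>.\<close>

lemma dual_pairs_factor_ratio:
  fixes Q :: rat
  assumes Q: "Q > 1" and i: "i < s" and s: "s \<le> r" and mn: "s + r \<le> m + n"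
  defines "g \<equiv> (Q ^ s / Q ^ i - Q ^ s / Q ^ s) * (Q ^ s / Q ^ Suc i)"
  shows "(Q ^ m / Q ^ i - Q ^ m / Q ^ r) * (Q ^ n / Q ^ Suc i)
    = Q ^ (m + n - r - s) * ((Q ^ (r - i) - 1) / (Q ^ (s - i) - 1)) * g \<and> g \<noteq> 0"
proof -
  have Q0: "Q ^ k \<noteq> 0" for k using Q by simp
  have diff: "Q ^ k / Q ^ i - Q ^ k / Q ^ l = (Q ^ (l - i) - 1) * (Q ^ k / Q ^ l)"
    if "i \<le> l" for k l
  proof -
    have l: "Q ^ l = Q ^ i * Q ^ (l - i)" using that by (simp flip: power_add)
    have "A / B - A / (B * C) = (C - 1) * (A / (B * C))" if "B \<noteq> 0" "C \<noteq> 0" for A B C :: rat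
      using that by (simp add: field_simps)
    from this[OF Q0 Q0] show ?thesis unfolding l .
  qed
  have ir: "i \<le> r" using i s by simp
  have "Q ^ (s - i) > 1" using Q i by (intro one_less_power) auto
  then have nz: "Q ^ (s - i) - 1 \<noteq> 0" by simp
  have g: "g = (Q ^ (s - i) - 1) * (Q ^ s / Q ^ Suc i)"
    unfolding g_def diff[OF less_imp_le[OF i]] by (simp only: divide_self[OF Q0] mult_1_right)
  have "m + n = (m + n - r - s) + r + s" using mn by simp
  then have e: "Q ^ m * Q ^ n = Q ^ (m + n - r - s) * Q ^ r * Q ^ s" by (metis power_add)
  \<comment> \<open>Field identities in plain variables, so that \<open>field_simps\<close> does not
    rearrange the powers.\<close>
  have cancel1: "a * (M / R) * (N / I) = a * ((M * N) / (R * I))"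
    and cancel2: "R \<noteq> 0 \<Longrightarrow> a * ((E * R * S) / (R * I)) = a * (E * (S / I))"
    and cancel3: "b \<noteq> 0 \<Longrightarrow> a * (E * S) = E * (a / b) * (b * S)" for a b E I M N R S :: rat
    by (simp_all add: field_simps)
  have "(Q ^ m / Q ^ i - Q ^ m / Q ^ r) * (Q ^ n / Q ^ Suc i)
      = (Q ^ (r - i) - 1) * ((Q ^ m * Q ^ n) / (Q ^ r * Q ^ Suc i))"
    unfolding diff[OF ir] by (rule cancel1)
  also have "\<dots> = (Q ^ (r - i) - 1) * (Q ^ (m + n - r - s) * (Q ^ s / Q ^ Suc i))"
    unfolding e by (rule cancel2[OF Q0])
  also have "\<dots> = Q ^ (m + n - r - s) * ((Q ^ (r - i) - 1) / (Q ^ (s - i) - 1)) * g"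
    unfolding g by (rule cancel3[OF nz])
  finally have "(Q ^ m / Q ^ i - Q ^ m / Q ^ r) * (Q ^ n / Q ^ Suc i)
    = Q ^ (m + n - r - s) * ((Q ^ (r - i) - 1) / (Q ^ (s - i) - 1)) * g" .
  moreover have "g \<noteq> 0" unfolding g using nz Q0[of s] Q0[of "Suc i"] by (metis mult_eq_0_iff divide_eq_0_iff)
  ultimately show ?thesis by blast
qed

lemma card_idempotents_of_rank:
  fixes m n r s :: nat
  assumes fin: "finite (UNIV :: 'a::field set)" and q: "Q = rat_of_nat (card (UNIV :: 'a set))"
    and r: "r \<le> min m n" and s: "s \<le> r"
  shows "rat_of_nat (card {X \<in> carrier_mat m n. X * (J_mat m n r :: 'a mat) * X = X
      \<and> vec_space.rank m X = s}) = Q ^ (s * (m + n - r - s)) * q_binomial Q r s"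
proof -
  let ?N = "rat_of_nat (card {X \<in> carrier_mat m n. X * (J_mat m n r :: 'a mat) * X = X
      \<and> vec_space.rank m X = s})"
  \<comment> \<open>A field contains at least the two elements 0 and 1, hence
    \<open>Q > 1\<close>.\<close>
  have "card {0, 1 :: 'a} \<le> card (UNIV :: 'a set)" using fin by (intro card_mono) auto
  then have Q: "Q > 1" by (simp add: q)
  define e where "e = m + n - r - s"
  let ?f = "\<lambda>i. (Q ^ m / Q ^ i - Q ^ m / Q ^ r) * (Q ^ n / Q ^ Suc i)"
  let ?g = "\<lambda>i. (Q ^ s / Q ^ i - Q ^ s / Q ^ s) * (Q ^ s / Q ^ Suc i)"
  have J: "(J_mat m n r :: 'a mat) = delta_mat n r * delta_mat r m"
    by (rule J_mat_eq_delta_mat[OF r])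
  have rn: "r \<le> n" and rm: "r \<le> m" using r by auto
  have "rat_of_nat (card (dual_pairs m n (J_mat m n r :: 'a mat) s))
      = (\<Prod>i<s. (Q ^ m / Q ^ i - Q ^ m / Q ^ r) * (Q ^ n / Q ^ Suc i))"
    by (rule card_dual_pairs[OF fin q delta_mat_carrier delta_mat_carrier delta_mat_left_inverse[OF rn]
      delta_mat_carrier delta_mat_carrier delta_mat_left_inverse[OF rm] J])
  moreover have "rat_of_nat (card (dual_pairs s s (1\<^sub>m s :: 'a mat) s)) = (\<Prod>i<s. ?g i)"
    \<comment> \<open>The order of the general linear group is the same count with
      \<open>m = n = r = s\<close> and every matrix the identity.\<close>
    by (rule card_dual_pairs[OF fin q, of "1\<^sub>m s" s s "1\<^sub>m s" "1\<^sub>m s" s "1\<^sub>m s"]) auto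
  moreover have "(J_mat m n r :: 'a mat) \<in> carrier_mat n m"
    unfolding J by (rule mult_carrier_mat[OF delta_mat_carrier delta_mat_carrier])
  then have "?N * rat_of_nat (card (dual_pairs s s (1\<^sub>m s :: 'a mat) s))
      = rat_of_nat (card (dual_pairs m n (J_mat m n r :: 'a mat) s))"
    by (simp only: of_nat_mult[symmetric] card_idempotents_mult_card_GL[OF fin])
  ultimately have eq: "?N * (\<Prod>i<s. ?g i) = (\<Prod>i<s. ?f i)" by (simp only:)
  have "s + r \<le> m + n" using r s by simp
  then have factor: "?f i = Q ^ e * ((Q ^ (r - i) - 1) / (Q ^ (s - i) - 1)) * ?g i" and g0: "?g i \<noteq> 0"
    if "i < s" for i
    using dual_pairs_factor_ratio[OF Q that s] unfolding e_def by blast+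
  have "(\<Prod>i<s. ?f i) = (\<Prod>i<s. Q ^ e * ((Q ^ (r - i) - 1) / (Q ^ (s - i) - 1)) * ?g i)"
    by (rule prod.cong[OF refl]) (rule factor, simp)
  also have "\<dots> = (\<Prod>i<s. Q ^ e) * q_binomial Q r s * (\<Prod>i<s. ?g i)"
    unfolding q_binomial_eq_prod[OF Q s] by (simp only: prod.distrib)
  finally have "?N * (\<Prod>i<s. ?g i) = (\<Prod>i<s. Q ^ e) * q_binomial Q r s * (\<Prod>i<s. ?g i)"
    unfolding eq .
  moreover have "(\<Prod>i<s. ?g i) \<noteq> 0"
    unfolding prod_zero_iff[OF finite_lessThan] using g0 by blast
  ultimately have "?N = (\<Prod>i<s. Q ^ e) * q_binomial Q r s" by (rule mult_right_cancel[THEN iffD1, rotated])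
  moreover have "(\<Prod>i<s. Q ^ e) = Q ^ (s * e)"
    by (simp add: power_mult[symmetric] mult.commute)
  ultimately show ?thesis by (simp only: e_def)
qed

section \<open>From idempotents of fixed rank to all idempotents\<close>

lemma idems_D_class:
  "idems J (D_class m n J s) = {X \<in> carrier_mat m n. X * J * X = X \<and> vec_space.rank m X = s}"
proof -
  \<comment> \<open>An idempotent is regular with itself as the witness.\<close>
  have "X \<in> Reg m n J" if "X \<in> carrier_mat m n" "X * J * X = X" for X
    using that by (auto simp: Reg_def sandwich_def intro!: bexI[of _ X])
  moreover have "X \<in> carrier_mat m n" if "X \<in> Reg m n J" for X
    using that by (simp add: Reg_def)
  ultimately show ?thesis by (auto simp: idems_def D_class_def sandwich_def)
qed

text \<open>Splitting \<open>J\<close> writes \<open>X\<close> as a product with inner dimension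
  \<open>r\<close>.\<close>

lemma rank_idempotent_le:
  fixes X :: "'a::field mat"
  assumes X: "X \<in> carrier_mat m n" and r: "r \<le> min m n" and idem: "X * J_mat m n r * X = X"
  shows "vec_space.rank m X \<le> r"
proof -
  have "X * delta_mat n r * (delta_mat r m * X) = X * (delta_mat n r * delta_mat r m) * X"
    using X by (simp add: mult_assoc_dim delta_mat_def)
  also have "\<dots> = X" using idem by (simp add: J_mat_eq_delta_mat[OF r])
  finally show ?thesis
    using vec_space.rank_mult_le[OF mult_carrier_mat[OF X delta_mat_carrier[of n r]]
      mult_carrier_mat[OF delta_mat_carrier[of r m] X]] by simp
qed

theorem proposition7p2:
  fixes J :: "'a::field mat" and m n r q :: nat
  assumes "m \<ge> 1" and "n \<ge> 1" and "r \<le> min m n"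
    and J: "J = J_mat m n r"
    and "finite (UNIV :: 'a set)" and "card (UNIV :: 'a set) = q"
    and "r \<ge> 1" and "\<not> (r = m \<and> m = n)"
  shows "(\<forall>s\<le>r. rat_of_nat (card (idems J (D_class m n J s)))
            = rat_of_nat q ^ (s * (m + n - r - s)) * q_binomial (rat_of_nat q) r s)
    \<and> rat_of_nat (card (idems J (carrier_mat m n)))
            = (\<Sum>s=0..r. rat_of_nat q ^ (s * (m + n - r - s)) * q_binomial (rat_of_nat q) r s)"
proof -
  have fin: "finite (UNIV :: 'a set)" by fact
  have each: "rat_of_nat (card (idems J (D_class m n J s)))
      = rat_of_nat q ^ (s * (m + n - r - s)) * q_binomial (rat_of_nat q) r s" if "s \<le> r" for s
    unfolding idems_D_class J
    by (rule card_idempotents_of_rank[OF fin _ assms(3) that]) (use assms(6) in simp)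
  \<comment> \<open>The rank sorts the idempotents into disjoint classes, and no rank above
    \<open>r\<close> occurs.\<close>
  have "idems J (carrier_mat m n) = (\<Union>s\<in>{0..r}. idems J (D_class m n J s))"
  proof -
    have "vec_space.rank m X \<le> r" if "X \<in> idems J (carrier_mat m n)" for X
      by (rule rank_idempotent_le[OF _ assms(3)]) (use that in \<open>simp_all add: idems_def sandwich_def J\<close>)
    then show ?thesis unfolding idems_D_class by (auto simp: idems_def sandwich_def)
  qed
  moreover have "card (\<Union>s\<in>{0..r}. idems J (D_class m n J s))
      = (\<Sum>s=0..r. card (idems J (D_class m n J s)))"
    unfolding idems_D_class
    by (rule card_UN_disjoint)
      (auto intro: finite_subset[OF _ finite_carrier_mat[OF fin, of m n]])
  ultimately show ?thesis using each by simp
qed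

end
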